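(* Let $t\le k$ be positive integers and $n,s\ge0$ integers. The number of words $w\in[k]^n$ with $\overleftarrow{\mathrm{des}}_{\{t+1,\ldots,k\}}(w)=s$, which also equals the number of words $w\in[k]^n$ with $\overleftarrow{\mathrm{ris}}_{[k-t]}(w)=s$, is $$\sum_{m=0}^n\sum_{a=0}^m\sum_{b=0}^{a}(-1)^{n-a-s}\binom{m}{a}\binom{a}{b}\binom{(k-t)a}{n-b}\binom{n-m}{s}t^b.$$
   Context: $[k]=\{1,\ldots,k\}$, $[k]^n$ is the set of words of length $n$ over $[k]$. For a word $w=w_1\cdots w_n$ and $X\subseteq\mathbb{N}$, $\overleftarrow{\mathrm{des}}_X(w)=|\{i:w_i>w_{i+1},\ w_i\in X\}|$ and $\overleftarrow{\mathrm{ris}}_X(w)=|\{i:w_i<w_{i+1},\ w_i\in X\}|$. Conventions: $\binom{a}{b}=0$ if $b<0$ or $b>a$ (for $a\ge0$), and $0^0=1$. *)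

theory Defs
  imports Complex_Main
begin

definition words :: "nat \<Rightarrow> nat \<Rightarrow> nat list set" where
  "words k n = {w. length w = n \<and> set w \<subseteq> {1..k}}"

text \<open>Positions are counted from 0, so \<open>w ! i\<close> is the letter usually written with index \<open>i + 1\<close>.\<close>

definition des :: "nat set \<Rightarrow> nat list \<Rightarrow> nat" where
  "des X w = card {i. Suc i < length w \<and> w ! i > w ! Suc i \<and> w ! i \<in> X}"

definition ris :: "nat set \<Rightarrow> nat list \<Rightarrow> nat" where
  "ris X w = card {i. Suc i < length w \<and> w ! i < w ! Suc i \<and> w ! i \<in> X}"

end

theory Submission
  imports Defs "HOL-Computational_Algebra.Polynomial"
begin

text \<open>Put \<open>y = q - 1\<close>. Expanding \<open>q ^ des\<close> as a sum over sets of marked descents, each with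
  weight \<open>y\<close>, cuts a word into blocks that are strictly decreasing and whose letters, except
  possibly the last, exceed \<open>t\<close>. Splitting off the first block gives a linear recurrence for the
  generating polynomials, i.e. their ordinary generating function in \<open>x\<close> is \<open>1 / (1 - D(xy) / y)\<close>
  with \<open>D(z) = (1 + z)^(k - t) * (1 + t z) - 1\<close>. Since \<open>D\<close> has no constant term, only the powers
  \<open>D^m\<close> with \<open>m \<le> n\<close> contribute to words of length \<open>n\<close>; expanding them and \<open>y^(n - m)\<close> binomially
  yields the formula. Replacing every letter \<open>x\<close> by \<open>k + 1 - x\<close> exchanges rises and descents.\<close>

section \<open>Words and the descent statistic\<close>

lemma finite_words: "finite (words k n)"
  unfolding words_def using finite_lists_length_eq[of "{1..k}" n] by (simp add: conj_commute)

lemma words_0: "words k 0 = {[]}"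
  by (auto simp: words_def)

lemma words_Suc: "words k (Suc n) = (\<lambda>(i, w). i # w) ` ({1..k} \<times> words k n)"
  by (auto simp: words_def length_Suc_conv image_iff)

lemma sum_words_Suc: "(\<Sum>w\<in>words k (Suc n). f w) = (\<Sum>i=1..k. \<Sum>w\<in>words k n. f (i # w))"
proof -
  have "inj_on (\<lambda>(i, w). i # w) ({1..k} \<times> words k n)"
    by (auto simp: inj_on_def)
  then show ?thesis
    unfolding words_Suc by (subst sum.reindex) (auto simp: sum.cartesian_product o_def case_prod_unfold)
qed

lemma des_singleton: "des X [x] = 0"
  by (simp add: des_def)

lemma des_Cons_Cons: "des X (x # y # w) = (if y < x \<and> x \<in> X then 1 else 0) + des X (y # w)"
proof -
  let ?A = "{i. Suc i < length (y # w) \<and> (y # w) ! i > (y # w) ! Suc i \<and> (y # w) ! i \<in> X}"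
  have "{i. Suc i < length (x # y # w) \<and> (x # y # w) ! i > (x # y # w) ! Suc i \<and> (x # y # w) ! i \<in> X}
      = (if y < x \<and> x \<in> X then {0} else {}) \<union> Suc ` ?A" (is "?B = _")
  proof (rule set_eqI)
    fix i show "i \<in> ?B \<longleftrightarrow> i \<in> (if y < x \<and> x \<in> X then {0} else {}) \<union> Suc ` ?A"
      by (cases i) auto
  qed
  moreover have "finite ?A"
    by (rule finite_subset[of _ "{..<length (y # w)}"]) auto
  ultimately show ?thesis
    unfolding des_def by (simp only:) (subst card_Un_disjoint; auto simp: card_image)
qed

lemma des_le_length: "des X w \<le> length w"
proof -
  have "des X w \<le> card {..<length w}"
    unfolding des_def by (rule card_mono) auto
  then show ?thesis by simp
qed

section \<open>Generating polynomials and their recurrence\<close>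

definition des_gf :: "nat \<Rightarrow> nat set \<Rightarrow> real \<Rightarrow> nat \<Rightarrow> real" where
  "des_gf k X q n = (\<Sum>w\<in>words k n. q ^ des X w)"

definition des_gf_from :: "nat \<Rightarrow> nat set \<Rightarrow> real \<Rightarrow> nat \<Rightarrow> nat \<Rightarrow> real" where
  "des_gf_from k X q i n = (\<Sum>w\<in>words k n. q ^ des X (i # w))"

lemma des_gf_0: "des_gf k X q 0 = 1"
  by (simp add: des_gf_def words_0 des_def)

lemma des_gf_Suc: "des_gf k X q (Suc n) = (\<Sum>i=1..k. des_gf_from k X q i n)"
  by (simp add: des_gf_def des_gf_from_def sum_words_Suc)

lemma des_gf_from_0: "des_gf_from k X q i 0 = 1"
  by (simp add: des_gf_from_def words_0 des_singleton)

lemma des_gf_from_notin: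
  assumes "i \<notin> X"
  shows "des_gf_from k X q i n = des_gf k X q n"
proof (cases n)
  case 0
  then show ?thesis by (simp add: des_gf_0 des_gf_from_0)
next
  case (Suc m)
  then show ?thesis
    using assms by (simp add: des_gf_def des_gf_from_def sum_words_Suc des_Cons_Cons)
qed

text \<open>Write \<open>q = 1 + (q - 1)\<close> for a descent at the leading \<open>i\<close>. The
  summand 1 ignores it and leaves an arbitrary word; the summand \<open>q - 1\<close> marks it and
  forces the next letter \<open>l\<close> below \<open>i\<close>. Since \<open>i \<le> k\<close>,
  every such \<open>l\<close> is in the alphabet.\<close>

lemma des_gf_from_Suc:
  assumes "i \<in> X" "i \<le> k"
  shows "des_gf_from k X q i (Suc n) =
    des_gf k X q (Suc n) + (q - 1) * (\<Sum>l=1..<i. des_gf_from k X q l n)"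
proof -
  have "des_gf_from k X q i (Suc n) =
      (\<Sum>l=1..k. des_gf_from k X q l n + (if l < i then (q - 1) * des_gf_from k X q l n else 0))"
    using assms(1) unfolding des_gf_from_def sum_words_Suc
    by (intro sum.cong refl) (auto simp: des_Cons_Cons algebra_simps simp flip: sum_distrib_left)
  also have "\<dots> = des_gf k X q (Suc n) +
      (\<Sum>l=1..k. if l < i then (q - 1) * des_gf_from k X q l n else 0)"
    by (simp add: sum.distrib des_gf_Suc)
  also have "(\<Sum>l=1..k. if l < i then (q - 1) * des_gf_from k X q l n else 0) =
      (\<Sum>l=1..<i. (q - 1) * des_gf_from k X q l n)"
    using assms(2) by (intro sum.mono_neutral_cong_right) auto
  finally show ?thesis by (simp add: sum_distrib_left)
qed

text \<open>The factor \<open>(r choose Suc j) + t * (r choose j)\<close> counts the strictly decreasing words of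
  length \<open>Suc j\<close> over \<open>{1..t + r}\<close> whose letters, except possibly the last, exceed \<open>t\<close>.\<close>

lemma sum_des_gf_from:
  assumes "t + r \<le> k"
  shows "(\<Sum>i=1..t + r. des_gf_from k {t+1..k} q i n) =
    (\<Sum>j\<le>n. (q - 1) ^ j * (real (r choose Suc j) + real t * real (r choose j)) * des_gf k {t+1..k} q (n - j))"
  using assms
proof (induction r arbitrary: n)
  case 0
  have "(\<Sum>i=1..t. des_gf_from k {t+1..k} q i n) = real t * des_gf k {t+1..k} q n"
    by (simp add: des_gf_from_notin)
  \<comment> \<open>With no letter above \<open>t\<close> available, a block has one letter, so only
    \<open>j = 0\<close> survives.\<close>
  moreover have "(\<Sum>j\<le>n. (q - 1) ^ j * (real (0 choose Suc j) + real t * real (0 choose j)) * des_gf k {t+1..k} q (n - j))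
     = (\<Sum>j\<in>{0}. (q - 1) ^ j * (real (0 choose Suc j) + real t * real (0 choose j)) * des_gf k {t+1..k} q (n - j))"
    by (rule sum.mono_neutral_right) (auto simp: binomial_eq_0)
  ultimately show ?case by simp
next
  case (Suc r)
  let ?G = "des_gf k {t+1..k} q"
  let ?H = "des_gf_from k {t+1..k} q"
  define y where "y = q - 1"
  have IH: "(\<Sum>i=1..t + r. ?H i n) =
    (\<Sum>j\<le>n. (q - 1) ^ j * (real (r choose Suc j) + real t * real (r choose j)) * ?G (n - j))" for n
    using Suc by simp
  have split: "(\<Sum>i=1..t + Suc r. ?H i n) = (\<Sum>i=1..t + r. ?H i n) + ?H (Suc (t + r)) n"
    by simp
  show ?case
  proof (cases n)
    case 0
    then show ?thesis unfolding split IH by (simp add: des_gf_0 des_gf_from_0)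
  next
    case (Suc m)
    \<comment> \<open>The new letter exceeds \<open>t\<close>, and the letters below it are exactly
      \<open>{1..t + r}\<close>, so \<open>IH\<close> applies at length \<open>m\<close>.\<close>
    have "?H (Suc (t + r)) n = ?G n + (q - 1) * (\<Sum>i=1..t + r. ?H i m)"
      using Suc.prems unfolding \<open>n = Suc m\<close>
      by (subst des_gf_from_Suc) (auto simp: atLeastLessThanSuc_atLeastAtMost)
    then have H: "?H (Suc (t + r)) n = ?G n +
        y * (\<Sum>j\<le>m. y ^ j * (real (r choose Suc j) + real t * real (r choose j)) * ?G (m - j))"
      by (simp only: IH y_def)
    show ?thesis
      \<comment> \<open>Pascal's rule adds the term for \<open>j\<close> in \<open>H\<close> to the
        term for \<open>Suc j\<close> in \<open>IH\<close>; the lone \<open>?G n\<close> raises the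
        coefficient at \<open>j = 0\<close> by 1.\<close>
      unfolding split IH H y_def[symmetric] unfolding \<open>n = Suc m\<close>
      by (simp add: sum.atMost_Suc_shift sum_distrib_left sum.distrib algebra_simps del: sum.atMost_Suc)
  qed
qed

lemma des_gf_rec:
  assumes "t \<le> k"
  shows "des_gf k {t+1..k} q (Suc n) =
    (\<Sum>j\<le>n. (q - 1) ^ j * (real ((k - t) choose Suc j) + real t * real ((k - t) choose j))
      * des_gf k {t+1..k} q (n - j))"
  using sum_des_gf_from[of t "k - t" k q n] assms by (simp add: des_gf_Suc)

section \<open>Powers of the block polynomial\<close>

definition cluster_poly :: "nat \<Rightarrow> nat \<Rightarrow> real poly" where
  "cluster_poly N t = [:1, 1:] ^ N * [:1, real t:] - 1"

lemma coeff_one_plus_X_power: "coeff ([:1, 1:] ^ N :: real poly) j = real (N choose j)"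
proof (induction N arbitrary: j)
  case 0
  then show ?case by (cases j) auto
next
  case (Suc N)
  then show ?case by (cases j) (auto simp: mult.commute coeff_pCons)
qed

lemma coeff_cluster_poly_0: "coeff (cluster_poly N t) 0 = 0"
  by (simp add: cluster_poly_def coeff_mult coeff_one_plus_X_power)

lemma coeff_cluster_poly_Suc:
  "coeff (cluster_poly N t) (Suc j) = real (N choose Suc j) + real t * real (N choose j)"
  unfolding cluster_poly_def mult.commute[of "[:1, 1:] ^ N"]
  by (simp add: coeff_one_plus_X_power)

text \<open>The zero constant term lets the Cauchy product start at index 1, which gives the same
  convolution as in \<open>des_gf_rec\<close>.\<close>

lemma coeff_cluster_poly_power_Suc:
  "coeff (cluster_poly N t ^ Suc m) (Suc n) =
    (\<Sum>j\<le>n. (real (N choose Suc j) + real t * real (N choose j)) * coeff (cluster_poly N t ^ m) (n - j))"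
  by (simp add: coeff_mult sum.atMost_Suc_shift coeff_cluster_poly_0 coeff_cluster_poly_Suc
      del: sum.atMost_Suc)

text \<open>\<open>cluster_poly N t\<close> is divisible by the variable, hence its
  \<open>m\<close>-th power by the \<open>m\<close>-th power of the variable.\<close>

lemma coeff_cluster_poly_power_eq_0:
  "n < m \<Longrightarrow> coeff (cluster_poly N t ^ m) n = 0"
proof (induction m arbitrary: n)
  case (Suc m)
  show ?case
  proof (cases n)
    case 0
    then show ?thesis by (simp add: coeff_mult coeff_cluster_poly_0)
  next
    case (Suc l)
    then show ?thesis
      unfolding Suc coeff_cluster_poly_power_Suc using Suc.IH \<open>n < Suc m\<close> Suc
      by (intro sum.neutral ballI mult_eq_0_iff[THEN iffD2] disjI2) auto
  qed
qed simp

lemma coeff_cluster_poly_power: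
  assumes "m \<le> n"
  shows "coeff (cluster_poly N t ^ m) n =
    (\<Sum>a=0..m. \<Sum>b=0..a. (-1) ^ (m - a) * real (m choose a) * real (a choose b)
       * real ((N * a) choose (n - b)) * real t ^ b)"
proof -
  have lin: "[:1, real t:] ^ a = (\<Sum>b\<le>a. monom (real (a choose b) * real t ^ b) b)" for a
  proof -
    have "[:1, real t:] ^ a = (monom (real t) 1 + 1) ^ a"
      by (simp add: monom_altdef one_pCons)
    also have "\<dots> = (\<Sum>b\<le>a. of_nat (a choose b) * monom (real t) 1 ^ b)"
      by (simp add: binomial_ring)
    also have "\<dots> = (\<Sum>b\<le>a. monom (real (a choose b) * real t ^ b) b)"
      by (simp add: monom_power of_nat_poly smult_monom)
    finally show ?thesis .
  qed
  have "cluster_poly N t ^ m = (([:1, 1:] ^ N * [:1, real t:]) + (- 1)) ^ m"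
    by (simp add: cluster_poly_def)
  also have "\<dots> = (\<Sum>a\<le>m. of_nat (m choose a) * ([:1, 1:] ^ N * [:1, real t:]) ^ a * (-1) ^ (m - a))"
    by (rule binomial_ring)
  also have "\<dots> = (\<Sum>a\<le>m. smult ((-1) ^ (m - a) * real (m choose a))
      (\<Sum>b\<le>a. monom (real (a choose b) * real t ^ b) b * [:1, 1:] ^ (N * a)))"
  proof (rule sum.cong[OF refl])
    fix a
    have "(-1 :: real poly) = [:-1:]"
      by (simp add: one_pCons)
    then have "(-1 :: real poly) ^ (m - a) = [:(-1) ^ (m - a):]"
      by (simp only: poly_const_pow)
    moreover have "([:1, 1:] ^ N * [:1, real t:]) ^ a =
        (\<Sum>b\<le>a. monom (real (a choose b) * real t ^ b) b * [:1, 1:] ^ (N * a))"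
      unfolding power_mult_distrib lin power_mult sum_distrib_left
      by (simp only: mult.commute)
    ultimately show "of_nat (m choose a) * ([:1, 1:] ^ N * [:1, real t:]) ^ a * (-1) ^ (m - a)
      = smult ((-1) ^ (m - a) * real (m choose a))
      (\<Sum>b\<le>a. monom (real (a choose b) * real t ^ b) b * [:1, 1:] ^ (N * a))"
      by (simp only: of_nat_poly) (simp add: mult.commute)
  qed
  finally have "coeff (cluster_poly N t ^ m) n =
     (\<Sum>a\<le>m. \<Sum>b\<le>a. (-1) ^ (m - a) * real (m choose a) *
        (real (a choose b) * real t ^ b * real ((N * a) choose (n - b))))"
    \<comment> \<open>As \<open>b \<le> a \<le> m \<le> n\<close>, each monomial has degree at most
      \<open>n\<close>, so \<open>n - b\<close> is a true difference.\<close>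
    using assms by (simp add: coeff_sum coeff_monom_mult coeff_one_plus_X_power sum_distrib_left)
  then show ?thesis
    by (simp add: atMost_atLeast0 mult_ac)
qed

text \<open>This is the geometric series read off coefficientwise, with no division by
  \<open>q - 1\<close>. In the induction, the recurrence turns the \<open>m\<close>-th power into
  the next one.\<close>

lemma des_gf_eq:
  assumes "t \<le> k"
  shows "des_gf k {t+1..k} q n = (\<Sum>m\<le>n. (q - 1) ^ (n - m) * coeff (cluster_poly (k - t) t ^ m) n)"
proof (induction n rule: less_induct)
  case (less n)
  let ?c = "\<lambda>j. real ((k - t) choose Suc j) + real t * real ((k - t) choose j)"
  let ?d = "\<lambda>m n. coeff (cluster_poly (k - t) t ^ m) n"
  show ?case
  proof (cases n)
    case 0
    then show ?thesis by (simp add: des_gf_0)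
  next
    case (Suc l)
    have "des_gf k {t+1..k} q n = (\<Sum>j\<le>l. (q - 1) ^ j * ?c j * des_gf k {t+1..k} q (l - j))"
      unfolding Suc by (rule des_gf_rec[OF assms])
    also have "\<dots> = (\<Sum>j\<le>l. \<Sum>m\<le>l. (q - 1) ^ (l - m) * (?c j * ?d m (l - j)))"
    proof (rule sum.cong[OF refl])
      fix j assume j: "j \<in> {..l}"
      have "(q - 1) ^ j * ?c j * des_gf k {t+1..k} q (l - j) =
          (\<Sum>m\<le>l - j. (q - 1) ^ j * ?c j * ((q - 1) ^ (l - j - m) * ?d m (l - j)))"
        using less.IH[of "l - j"] Suc by (simp add: sum_distrib_left)
      also have "\<dots> = (\<Sum>m\<le>l - j. (q - 1) ^ (l - m) * (?c j * ?d m (l - j)))"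
      proof (rule sum.cong[OF refl])
        fix m assume "m \<in> {..l - j}"
        then have "l - m = j + (l - j - m)" using j by auto
        then show "(q - 1) ^ j * ?c j * ((q - 1) ^ (l - j - m) * ?d m (l - j)) =
            (q - 1) ^ (l - m) * (?c j * ?d m (l - j))"
          by (simp add: power_add mult_ac)
      qed
      \<comment> \<open>The added terms vanish; a range independent of \<open>j\<close> allows the
        sums to be swapped.\<close>
      also have "\<dots> = (\<Sum>m\<le>l. (q - 1) ^ (l - m) * (?c j * ?d m (l - j)))"
        by (rule sum.mono_neutral_left) (auto simp: coeff_cluster_poly_power_eq_0)
      finally show "(q - 1) ^ j * ?c j * des_gf k {t+1..k} q (l - j) =
          (\<Sum>m\<le>l. (q - 1) ^ (l - m) * (?c j * ?d m (l - j)))" .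
    qed
    also have "\<dots> = (\<Sum>m\<le>l. (q - 1) ^ (l - m) * ?d (Suc m) n)"
      unfolding Suc coeff_cluster_poly_power_Suc sum_distrib_left by (rule sum.swap)
    \<comment> \<open>After the shift, the extra term \<open>m = 0\<close> is a positive-degree
      coefficient of the polynomial 1, hence 0.\<close>
    also have "\<dots> = (\<Sum>m\<le>n. (q - 1) ^ (n - m) * ?d m n)"
      unfolding Suc by (simp add: sum.atMost_Suc_shift del: sum.atMost_Suc power_Suc)
    finally show ?thesis .
  qed
qed

section \<open>Extracting the coefficient of a power of \<open>q\<close>\<close>

lemma des_gf_eq_sum_card:
  "des_gf k X q n = (\<Sum>s\<le>n. real (card {w \<in> words k n. des X w = s}) * q ^ s)"
proof -
  have "des X ` words k n \<subseteq> {..n}"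
    using des_le_length by (fastforce simp: words_def)
  then have "des_gf k X q n = (\<Sum>s\<le>n. \<Sum>w\<in>{w \<in> words k n. des X w = s}. q ^ des X w)"
    unfolding des_gf_def by (intro sum.group[symmetric]) (auto simp: finite_words)
  also have "\<dots> = (\<Sum>s\<le>n. real (card {w \<in> words k n. des X w = s}) * q ^ s)"
    by (intro sum.cong) auto
  finally show ?thesis .
qed

text \<open>The range is extended to a common \<open>n\<close> so that different \<open>l\<close>
  can be compared. For \<open>s > l\<close> the exponent is negative, hence \<open>powi\<close>, and
  the binomial coefficient is 0.\<close>

lemma minus_one_power_binomial:
  fixes q :: real
  assumes "l \<le> n"
  shows "(q - 1) ^ l = (\<Sum>s\<le>n. (-1) powi (int l - int s) * real (l choose s) * q ^ s)"
proof -
  have "(q + (-1)) ^ l = (\<Sum>s\<le>l. real (l choose s) * q ^ s * (-1) ^ (l - s))"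
    by (rule binomial_ring)
  also have "\<dots> = (\<Sum>s\<le>l. (-1) powi (int l - int s) * real (l choose s) * q ^ s)"
    by (intro sum.cong) (auto simp: power_int_def nat_diff_distrib)
  also have "\<dots> = (\<Sum>s\<le>n. (-1) powi (int l - int s) * real (l choose s) * q ^ s)"
    using assms by (intro sum.mono_neutral_left) auto
  finally show ?thesis by simp
qed

text \<open>For \<open>s \<le> n\<close> both sides are coefficients of polynomials in
  \<open>q\<close> that agree at every real \<open>q\<close>. For \<open>s > n\<close> both sides
  vanish.\<close>

lemma card_des_eq:
  assumes "t \<le> k"
  shows "real (card {w \<in> words k n. des {t+1..k} w = s}) =
    (\<Sum>m\<le>n. (-1) powi (int (n - m) - int s) * real ((n - m) choose s)
       * coeff (cluster_poly (k - t) t ^ m) n)"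
    (is "_ = ?R s")
proof (cases "s \<le> n")
  case True
  have "(\<Sum>s\<le>n. real (card {w \<in> words k n. des {t+1..k} w = s}) * q ^ s) = (\<Sum>s\<le>n. ?R s * q ^ s)"
    for q
  proof -
    have "(\<Sum>s\<le>n. real (card {w \<in> words k n. des {t+1..k} w = s}) * q ^ s) =
        (\<Sum>m\<le>n. (q - 1) ^ (n - m) * coeff (cluster_poly (k - t) t ^ m) n)"
      using des_gf_eq[OF assms] des_gf_eq_sum_card by metis
    also have "\<dots> = (\<Sum>m\<le>n. \<Sum>s\<le>n. (-1) powi (int (n - m) - int s) * real ((n - m) choose s)
        * coeff (cluster_poly (k - t) t ^ m) n * q ^ s)"
      by (intro sum.cong refl, subst minus_one_power_binomial[of _ n])
        (auto simp: sum_distrib_left sum_distrib_right mult_ac)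
    also have "\<dots> = (\<Sum>s\<le>n. ?R s * q ^ s)"
      unfolding sum_distrib_right by (rule sum.swap)
    finally show ?thesis .
  qed
  then have "\<forall>s\<le>n. real (card {w \<in> words k n. des {t+1..k} w = s}) = ?R s"
    by (intro polyfun_eq_coeffs[THEN iffD1] allI)
  then show ?thesis using True by blast
next
  case False
  then have "{w \<in> words k n. des {t+1..k} w = s} = {}"
    using des_le_length by (fastforce simp: words_def)
  moreover have "?R s = 0"
    using False by (intro sum.neutral) (auto simp: binomial_eq_0)
  ultimately show ?thesis by (simp only: card.empty of_nat_0)
qed

section \<open>Rises by complementation\<close>

text \<open>Complementation reverses the order and carries \<open>{1..k - t}\<close> onto
  \<open>{t+1..k}\<close>. Letters of \<open>w\<close> are at most \<open>k\<close>, so the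
  subtraction is not truncated.\<close>

lemma des_map_complement:
  assumes "w \<in> words k n"
  shows "des {t+1..k} (map (\<lambda>x. k + 1 - x) w) = ris {1..k - t} w"
proof -
  have letter: "1 \<le> w ! i \<and> w ! i \<le> k" if "i < length w" for i
    using assms nth_mem[OF that] by (auto simp: words_def)
  have "Suc i < length w \<and> k + 1 - w ! Suc i < k + 1 - w ! i \<and> k + 1 - w ! i \<in> {t+1..k} \<longleftrightarrow>
      Suc i < length w \<and> w ! i < w ! Suc i \<and> w ! i \<in> {1..k - t}" for i
    using letter[of i] letter[of "Suc i"] by auto
  moreover have "{i. Suc i < length (map (\<lambda>x. k + 1 - x) w)
        \<and> map (\<lambda>x. k + 1 - x) w ! i > map (\<lambda>x. k + 1 - x) w ! Suc i
        \<and> map (\<lambda>x. k + 1 - x) w ! i \<in> {t+1..k}} =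
      {i. Suc i < length w \<and> k + 1 - w ! Suc i < k + 1 - w ! i \<and> k + 1 - w ! i \<in> {t+1..k}}"
    by (rule Collect_cong) (metis Suc_lessD length_map nth_map)
  ultimately show ?thesis unfolding des_def ris_def by simp
qed

lemma card_ris_eq_card_des:
  "card {w \<in> words k n. ris {1..k - t} w = s} = card {w \<in> words k n. des {t+1..k} w = s}"
proof (rule bij_betw_same_card)
  let ?c = "map (\<lambda>x. k + 1 - x)"
  have c_words: "?c w \<in> words k n" and c_c: "?c (?c w) = w" if "w \<in> words k n" for w
    using that by (auto simp: words_def subset_iff intro!: map_idI Suc_leI)
  show "bij_betw ?c {w \<in> words k n. ris {1..k - t} w = s} {w \<in> words k n. des {t+1..k} w = s}"
  \<comment> \<open>Complementation is an involution on \<open>words k n\<close>, so it is its own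
    inverse.\<close>
  proof (rule bij_betw_byWitness[where f' = ?c])
    show "?c ` {w \<in> words k n. des {t+1..k} w = s} \<subseteq> {w \<in> words k n. ris {1..k - t} w = s}"
      using c_words c_c des_map_complement by fastforce
  qed (use c_words c_c des_map_complement in auto)
qed

theorem theorem4p2:
  fixes k t n s :: nat
  assumes "1 \<le> t" and "t \<le> k"
  shows "real (card {w \<in> words k n. des {t+1..k} w = s}) =
           (\<Sum>m=0..n. \<Sum>a=0..m. \<Sum>b=0..a.
              (-1) powi (int n - int a - int s) * real (m choose a) * real (a choose b)
              * real (((k - t) * a) choose (n - b)) * real ((n - m) choose s) * real t ^ b)
       \<and> card {w \<in> words k n. ris {1..k - t} w = s} = card {w \<in> words k n. des {t+1..k} w = s}"
proof
  \<comment> \<open>The exponents \<open>n - m - s\<close> and \<open>m - a\<close> add up to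
    \<open>n - a - s\<close>, so \<open>m\<close> drops out of the sign.\<close>
  have sign: "(-1) powi (int (n - m) - int s) * (-1) ^ (m - a) = ((-1) powi (int n - int a - int s) :: real)"
    if "m \<le> n" "a \<le> m" for m a
  proof -
    have "int n - int a - int s = (int (n - m) - int s) + int (m - a)"
      using that by simp
    then show ?thesis by (simp only: power_int_add[of "-1 :: real"] power_int_of_nat neg_equal_0_iff_equal one_neq_zero simp_thms)
  qed
  have "(-1) powi (int (n - m) - int s) * real ((n - m) choose s) * coeff (cluster_poly (k - t) t ^ m) n =
      (\<Sum>a=0..m. \<Sum>b=0..a. (-1) powi (int n - int a - int s) * real (m choose a) * real (a choose b)
              * real (((k - t) * a) choose (n - b)) * real ((n - m) choose s) * real t ^ b)"
    if "m \<le> n" for m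
    unfolding coeff_cluster_poly_power[OF that] sum_distrib_left
  proof (intro sum.cong refl)
    fix a b assume "a \<in> {0..m}"
    then have "a \<le> m" by simp
    show "(-1) powi (int (n - m) - int s) * real ((n - m) choose s) *
        ((-1) ^ (m - a) * real (m choose a) * real (a choose b) * real (((k - t) * a) choose (n - b)) * real t ^ b) =
      (-1) powi (int n - int a - int s) * real (m choose a) * real (a choose b)
        * real (((k - t) * a) choose (n - b)) * real ((n - m) choose s) * real t ^ b"
      unfolding sign[OF that \<open>a \<le> m\<close>, symmetric] by (simp only: mult_ac)
  qed
  then show "real (card {w \<in> words k n. des {t+1..k} w = s}) =
           (\<Sum>m=0..n. \<Sum>a=0..m. \<Sum>b=0..a.
              (-1) powi (int n - int a - int s) * real (m choose a) * real (a choose b)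
              * real (((k - t) * a) choose (n - b)) * real ((n - m) choose s) * real t ^ b)"
    unfolding card_des_eq[OF assms(2)] by (intro sum.cong) auto
qed (rule card_ris_eq_card_des)

end
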